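(* Let $q=2^m$ and let $g:S\to F$ be a function with $g(u)\neq 0$ for all $u\in S$. Let $H=\{u/g(u): u\in S\}\cup\{0\}\subseteq K$. Then the following are equivalent: (a) $H$ is a hyperoval; (b) for each $b\in K$, the equation $g(u)+\langle u,b\rangle=0$ has an even number of solutions $u\in S$; (c) for each $v\in S$ and each $1\le k\le q$, $$\sum_{u\in S}\left\langle v,\frac{u}{g(u)}\right\rangle^k=0.$$
   Context: Let $q=2^m$, $F=\mathbb{F}_q$, $K=\mathbb{F}_{q^2}$, and for $x\in K$ write $\bar x=x^q$. Let $S=\{u\in K: u^{q+1}=1\}$ and define the $F$-valued bilinear form $\langle x,y\rangle=x\bar y+\bar x y$ on $K$. The affine plane $AG(2,q)$ is identified with $K$: its points are the elements of $K$ and its lines are the sets $L(u,\mu)=\{x\in K:\langle u,x\rangle+\mu=0\}$ with $u\in S$, $\mu\in F$. A hyperoval is a set of $q+2$ points of $K$, no three of which lie on a common line. *)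

theory Defs
  imports Main "HOL-Library.Cardinality"
begin

definition is_subfield :: "'a::field set \<Rightarrow> bool" where
  "is_subfield F \<longleftrightarrow> 0 \<in> F \<and> 1 \<in> F \<and>
     (\<forall>x\<in>F. \<forall>y\<in>F. x + y \<in> F \<and> x * y \<in> F) \<and>
     (\<forall>x\<in>F. - x \<in> F \<and> inverse x \<in> F)"

definition bar :: "nat \<Rightarrow> 'a::field \<Rightarrow> 'a" where
  "bar q x = x ^ q"

definition unit_circle :: "nat \<Rightarrow> 'a::field set" where
  "unit_circle q = {u. u ^ (q + 1) = 1}"

definition bform :: "nat \<Rightarrow> 'a::field \<Rightarrow> 'a \<Rightarrow> 'a" where
  "bform q x y = x * bar q y + bar q x * y"

definition line :: "nat \<Rightarrow> 'a::field \<Rightarrow> 'a \<Rightarrow> 'a set" where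
  "line q u \<mu> = {x. bform q u x + \<mu> = 0}"

text \<open>The points of the affine plane are all elements of the type \<^typ>\<open>'a\<close>, which plays
  the role of the field with \<open>q\<^sup>2\<close> elements; \<open>F\<close> is its subfield with \<open>q\<close> elements.\<close>

definition ag_lines :: "nat \<Rightarrow> 'a::field set \<Rightarrow> 'a set set" where
  "ag_lines q F = {line q u \<mu> | u \<mu>. u \<in> unit_circle q \<and> \<mu> \<in> F}"

definition hyperoval :: "nat \<Rightarrow> 'a::field set \<Rightarrow> 'a set \<Rightarrow> bool" where
  "hyperoval q F H \<longleftrightarrow> finite H \<and> card H = q + 2 \<and>
     (\<forall>x\<in>H. \<forall>y\<in>H. \<forall>z\<in>H. x \<noteq> y \<and> y \<noteq> z \<and> x \<noteq> z \<longrightarrow>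
        \<not> (\<exists>l\<in>ag_lines q F. x \<in> l \<and> y \<in> l \<and> z \<in> l))"

end

theory Submission
  imports Defs "HOL-Computational_Algebra.Polynomial"
begin

text \<open>Every nonzero point is uniquely \<open>\<mu>u\<close> with \<open>\<mu> \<in> F\<^sup>*\<close> and \<open>u \<in> S\<close> (in characteristic 2 the
  norm \<open>x\<^sup>q\<^sup>+\<^sup>1 \<in> F\<close> has a square root in \<open>F\<close>), and \<open>\<langle>u, w\<rangle> = (u + w)\<^sup>2 / uw\<close> for \<open>u, w \<in> S\<close>, so a
  nonzero point is orthogonal to exactly one element of \<open>S\<close>. Hence the lines through a point \<open>P\<close>
  of a set \<open>H\<close> of \<open>q + 2\<close> points are indexed by \<open>S\<close>, and \<open>Q \<mapsto> PQ\<close> maps the other \<open>q + 1\<close> points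
  of \<open>H\<close> to \<open>q + 1\<close> lines. This map is injective for all \<open>P\<close> iff \<open>H\<close> is a hyperoval, and it is
  surjective if all lines meet \<open>H\<close> evenly, so the two properties coincide. The lines through \<open>0\<close>
  meet the given \<open>H\<close> in two points, and (b) says that the others meet it evenly. Finally (c) is
  equivalent to (b) since \<open>\<Sum>\<^sub>0\<^sub><\<^sub>k\<^sub><\<^sub>q (x / c)\<^sup>k\<close> is the indicator of \<open>x = c\<close> on \<open>F\<close>, for \<open>c \<in> F\<^sup>*\<close>.\<close>

section \<open>Finite fields: Fermat's little theorem and the characteristic\<close>

lemma is_subfield_UNIV: "is_subfield UNIV"
  by (simp add: is_subfield_def)

text \<open>For \<open>x\<close> nonzero, multiplication by \<open>x\<close> permutes the nonzero
  elements of \<open>F\<close>, and comparing their products gives \<open>x ^ card ?G = 1\<close>.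
  The case \<open>F = UNIV\<close> later makes conjugation an involution.\<close>

lemma subfield_power_card:
  fixes F :: "'a::field set"
  assumes F: "is_subfield F" "finite F" and x: "x \<in> F"
  shows "x ^ card F = x"
proof (cases "x = 0")
  case True
  have "card F \<noteq> 0" using F by (auto simp: is_subfield_def)
  then show ?thesis using True by simp
next
  case False
  let ?G = "F - {0}"
  have inj: "inj_on ((*) x) ?G" using False by (auto simp: inj_on_def)
  have img: "(*) x ` ?G = ?G"
    by (rule endo_inj_surj[OF _ _ inj]) (use F x False in \<open>auto simp: is_subfield_def\<close>)
  have "\<Prod>?G = (\<Prod>y\<in>(*) x ` ?G. y)" by (simp add: img)
  also have "\<dots> = (\<Prod>y\<in>?G. x * y)" by (simp add: prod.reindex[OF inj])
  also have "\<dots> = x ^ card ?G * \<Prod>?G" by (simp add: prod.distrib)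
  finally have "x ^ card ?G = 1" using F(2) by auto
  moreover have "card F = Suc (card ?G)"
    using F by (metis card.remove is_subfield_def)
  ultimately show ?thesis by simp
qed

text \<open>Translation by 1 permutes the field, so it preserves the sum of all elements, although
  it adds 1 once per element.\<close>

lemma of_nat_card_field: "of_nat CARD('a) = (0 :: 'a::{field,finite})"
proof -
  have "(\<Sum>x\<in>UNIV. x) = (\<Sum>x\<in>UNIV. x + (1::'a))"
    by (rule sum.reindex_bij_witness[of _ "\<lambda>x. x + 1" "\<lambda>x. x - 1"]) auto
  then show ?thesis by (simp add: sum.distrib)
qed

section \<open>Arithmetic in characteristic 2 and the subfield \<open>F\<close>\<close>

locale plane =
  fixes m q :: nat and F :: "'a::{field,finite} set"
  assumes q: "q = 2 ^ m"
    and K: "CARD('a) = q ^ 2"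
    and F: "is_subfield F" "card F = q"
begin

abbreviation "S \<equiv> unit_circle q :: 'a set"
abbreviation B :: "'a \<Rightarrow> 'a \<Rightarrow> 'a" where "B \<equiv> bform q"

lemma F_closed:
  "0 \<in> F" "1 \<in> F" "x \<in> F \<Longrightarrow> y \<in> F \<Longrightarrow> x + y \<in> F" "x \<in> F \<Longrightarrow> y \<in> F \<Longrightarrow> x * y \<in> F"
  "x \<in> F \<Longrightarrow> inverse x \<in> F" "x \<in> F \<Longrightarrow> y \<in> F \<Longrightarrow> x / y \<in> F"
  using F(1) by (auto simp: is_subfield_def divide_inverse)

lemma q_ge2: "q \<ge> 2"
proof -
  have "card {0, 1 :: 'a} \<le> CARD('a)" by (rule card_mono) auto
  then have "m \<noteq> 0" using K q by (intro notI) auto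
  then show ?thesis using q self_le_power[of 2 m] by simp
qed

text \<open>The number of elements is a power of 2 and vanishes in the field, so 2 is nilpotent
  there.\<close>

lemma two_zero: "(2::'a) = 0"
proof -
  have "(2::'a) ^ (m * 2) = 0"
    using of_nat_card_field[where 'a='a] by (simp add: K q power_mult)
  then show ?thesis by simp
qed

lemma add_self: "x + x = (0::'a)"
  using two_zero by (metis mult_2 mult_zero_left)

lemma add_eq_0: "x + y = 0 \<longleftrightarrow> x = (y::'a)"
  by (metis add_self add_left_cancel)

lemma of_nat_even: "of_nat n = (0::'a) \<longleftrightarrow> even n"
proof (cases "even n")
  case True
  then show ?thesis by (auto elim!: evenE simp: two_zero)
next
  case False
  then show ?thesis by (auto elim!: oddE simp: two_zero)
qed

text \<open>Squaring is additive in characteristic 2, and raising to the power \<open>q\<close> is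
  \<open>m\<close>-fold squaring.\<close>

lemma add_power_q: "(x + y) ^ q = x ^ q + (y ^ q :: 'a)"
proof -
  have "(x + y) ^ (2 ^ n) = x ^ (2 ^ n) + (y ^ (2 ^ n) :: 'a)" for n
    by (induction n) (simp_all add: power_Suc2 power_mult power2_sum two_zero del: power_Suc)
  then show ?thesis by (simp add: q)
qed

lemma power_q_q: "(x ^ q) ^ q = (x::'a)"
  using subfield_power_card[OF is_subfield_UNIV, of x] K
  by (simp add: power2_eq_square power_mult)

text \<open>All \<open>q\<close> elements of \<open>F\<close> are roots of X^q - X, which has at
  most \<open>q\<close> roots. Membership in \<open>F\<close> thus becomes an equation to compute
  with.\<close>

lemma F_iff: "x \<in> F \<longleftrightarrow> x ^ q = x"
proof -
  let ?p = "monom 1 q - monom 1 1 :: 'a poly"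
  have "coeff ?p q = 1" using q_ge2 by simp
  then have p: "?p \<noteq> 0" by (metis coeff_0 zero_neq_one)
  have deg: "degree ?p \<le> q"
    using q_ge2 by (intro degree_diff_le) (simp_all add: degree_monom_eq)
  have sub: "F \<subseteq> {x. poly ?p x = 0}"
    using subfield_power_card[OF F(1)] F(2) by (auto simp: poly_monom)
  have "F = {x. poly ?p x = 0}"
    by (rule card_seteq[OF _ sub]) (use card_poly_roots_bound[OF p] deg F(2) in auto)
  then show ?thesis by (auto simp: poly_monom)
qed

section \<open>The unit circle, the form and polar coordinates\<close>

lemma S_nonzero: "u \<in> S \<Longrightarrow> u \<noteq> 0"
  using q_ge2 by (auto simp: unit_circle_def)

lemma S_power_q: "u \<in> S \<Longrightarrow> u ^ q = inverse u"
  using S_nonzero[of u] by (simp add: unit_circle_def field_simps)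

text \<open>Conjugation swaps the two summands of the form, so its values are fixed by it.\<close>

lemma bform_in_F: "B x y \<in> F"
  unfolding F_iff
  by (simp add: bform_def bar_def add_power_q power_mult_distrib power_q_q add.commute)

lemma bform_commute: "B x y = B y x"
  by (simp add: bform_def algebra_simps)

lemma bform_add: "B x (y + z) = B x y + B x z"
  by (simp add: bform_def bar_def add_power_q algebra_simps)

lemma bform_0: "B x 0 = 0"
  using q_ge2 by (simp add: bform_def bar_def)

lemma bform_scale: "c \<in> F \<Longrightarrow> B x (c * y) = c * B x y"
  by (simp add: bform_def bar_def power_mult_distrib F_iff algebra_simps)

lemma bform_divide: "c \<in> F \<Longrightarrow> B x (y / c) = B x y / c"
  using bform_scale[of "inverse c" x y] F_closed(5)[of c] by (simp add: field_simps)

lemma bform_unit_eq_0: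
  assumes "u \<in> S" "w \<in> S"
  shows "B u w = 0 \<longleftrightarrow> u = w"
proof -
  have nz: "u \<noteq> 0" "w \<noteq> 0" using assms S_nonzero by auto
  have "(u + w) ^ 2 = u ^ 2 + w ^ 2" by (simp add: power2_sum two_zero)
  \<comment> \<open>On \<open>S\<close> conjugation is inversion, so the form is u/w + w/u.\<close>
  then have "B u w = (u + w) ^ 2 / (u * w)"
    using nz assms by (simp add: bform_def bar_def S_power_q field_simps power2_eq_square)
  then show ?thesis using nz by (simp add: add_eq_0)
qed

lemma polar:
  assumes "x \<noteq> 0"
  obtains c u where "c \<in> F" "c \<noteq> 0" "u \<in> S" "x = c * u"
proof
  let ?n = "x ^ q * x"
  \<comment> \<open>The norm \<open>?n\<close> is fixed by the power \<open>q\<close>, so raising it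
    to \<open>2 ^ (m - 1)\<close>, which is q/2, extracts its square root. With \<open>c\<close> in
    \<open>F\<close> this gives \<open>c ^ (q + 1) = c ^ 2 = ?n\<close>.\<close>
  define c where "c = ?n ^ (2 ^ (m - 1))"
  have n: "?n ^ q = ?n" by (simp add: power_mult_distrib power_q_q)
  have "2 ^ (m - 1) * 2 = q" using q q_ge2 by (cases m) auto
  then have c2: "c ^ 2 = ?n" using n by (simp add: c_def flip: power_mult)
  show cF: "c \<in> F"
    unfolding F_iff c_def by (metis n power_mult mult.commute)
  show c0: "c \<noteq> 0" using assms by (simp add: c_def)
  have "c ^ (q + 1) = c ^ 2" using cF by (simp add: F_iff power2_eq_square)
  also have "\<dots> = x ^ (q + 1)" using c2 by (simp add: mult.commute)
  finally have "c ^ (q + 1) = x ^ (q + 1)" .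
  moreover have "x ^ (q + 1) \<noteq> 0" using assms by simp
  ultimately have "(x / c) ^ (q + 1) = 1" unfolding power_divide by (metis divide_self)
  then show "x / c \<in> S" by (simp add: unit_circle_def)
  show "x = c * (x / c)" using c0 by simp
qed

lemma polar_unique:
  assumes "c \<in> F" "d \<in> F" "c \<noteq> 0" "u \<in> S" "w \<in> S" "c * u = d * w"
  shows "u = w" "c = d"
proof -
  \<comment> \<open>Pairing with \<open>w\<close> kills the right-hand side, because
    \<open>B w w = 0\<close>.\<close>
  have "c * B w u = d * B w w"
    using assms bform_scale by metis
  then show "u = w" using assms bform_unit_eq_0[of w u] bform_unit_eq_0[of w w] by simp
  then show "c = d" using assms S_nonzero by auto
qed

text \<open>Polar coordinates match the q^2 - 1 nonzero points with the pairs from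
  \<open>F - {0}\<close> and \<open>S\<close>; cancel q - 1.\<close>

lemma card_unit_circle: "card S = q + 1"
proof -
  have "bij_betw (\<lambda>(c, u). c * u) ((F - {0}) \<times> S) (- {0})"
    unfolding bij_betw_def
  proof
    show "inj_on (\<lambda>(c, u). c * u) ((F - {0}) \<times> S)"
      by (auto simp: inj_on_def dest: polar_unique)
    show "(\<lambda>(c, u). c * u) ` ((F - {0}) \<times> S) = - {0}" (is "?L = _")
    proof
      show "?L \<subseteq> - {0}" using S_nonzero by auto
      show "- {0} \<subseteq> ?L"
      proof
        fix x :: 'a assume "x \<in> - {0}"
        then obtain c u where "c \<in> F" "c \<noteq> 0" "u \<in> S" "x = c * u" using polar by auto
        then show "x \<in> ?L" by force
      qed
    qed
  qed
  then have "card ((F - {0}) \<times> S) = card (- {0 :: 'a})" by (rule bij_betw_same_card)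
  also have "\<dots> = q ^ 2 - 1" by (simp add: Compl_eq_Diff_UNIV K)
  also have "\<dots> = (q - 1) * (q + 1)" by (simp add: power2_eq_square algebra_simps)
  also have "card ((F - {0}) \<times> S) = (q - 1) * card S"
    using F_closed(1) by (simp add: card_cartesian_product F(2))
  finally have "(q - 1) * card S = (q - 1) * (q + 1)" .
  then show ?thesis using q_ge2 unfolding mult_cancel1 by simp
qed

section \<open>Directions and lines through a point\<close>

lemma unique_direction:
  assumes "x \<noteq> 0"
  shows "\<exists>!u. u \<in> S \<and> B u x = 0"
proof -
  obtain c w where "c \<in> F" "c \<noteq> 0" "w \<in> S" "x = c * w" using polar assms by metis
  then have "u \<in> S \<Longrightarrow> B u x = 0 \<longleftrightarrow> u = w" for u
    using bform_unit_eq_0 by (simp add: bform_scale)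
  with \<open>w \<in> S\<close> show ?thesis by blast
qed

text \<open>In characteristic 2, \<open>x + p\<close> is the difference of two points, so for
  \<open>x \<noteq> p\<close> the value \<open>direction (x + p)\<close> is the parameter in
  \<open>S\<close> of the line joining them. The value at 0 is irrelevant.\<close>

definition direction :: "'a \<Rightarrow> 'a" where
  "direction x = (THE u. u \<in> S \<and> B u x = 0)"

lemma direction_in: "x \<noteq> 0 \<Longrightarrow> direction x \<in> S"
  unfolding direction_def using theI'[OF unique_direction] by blast

lemma direction_eq_iff: "x \<noteq> 0 \<Longrightarrow> u \<in> S \<Longrightarrow> direction x = u \<longleftrightarrow> B u x = 0"
  unfolding direction_def
  using theI'[OF unique_direction[of x]] unique_direction[of x] by blast

lemma mem_line: "x \<in> line q u c \<longleftrightarrow> B u x = c"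
  by (simp add: line_def add_eq_0)

lemma direction_eq_iff_line:
  assumes "x \<noteq> p" "u \<in> S"
  shows "direction (x + p) = u \<longleftrightarrow> x \<in> line q u (B u p)"
  using assms direction_eq_iff[of "x + p" u] by (simp add: mem_line bform_add add_eq_0)

section \<open>Hyperovals as sets met evenly by every line\<close>

lemma hyperoval_iff_even:
  assumes card: "card H = q + 2"
  shows "hyperoval q F H \<longleftrightarrow> (\<forall>u\<in>S. \<forall>c\<in>F. even (card (H \<inter> line q u c)))"
proof -
  let ?d = "\<lambda>p x. direction (x + p)"
  have card': "card (H - {p}) = card S" if "p \<in> H" for p
    using that card by (simp add: card_unit_circle)
  have into: "?d p ` (H - {p}) \<subseteq> S" for p
    using direction_in add_eq_0 by blast
  have line_in: "line q u (B u p) \<in> ag_lines q F" if "u \<in> S" for u p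
    using that bform_in_F by (auto simp: ag_lines_def)
  \<comment> \<open>The intersection is a fibre of the direction map with \<open>p\<close> added: an
    empty fibre makes its size odd, a one-point fibre makes it 2.\<close>
  have inter: "H \<inter> line q u (B u p) = insert p {x \<in> H - {p}. ?d p x = u}"
    if "p \<in> H" "u \<in> S" for p u
    using that direction_eq_iff_line[of _ p u] by (auto simp: mem_line[of p])
  have hyp: "hyperoval q F H \<longleftrightarrow> (\<forall>p\<in>H. inj_on (?d p) (H - {p}))"
  proof
    assume h: "hyperoval q F H"
    show "\<forall>p\<in>H. inj_on (?d p) (H - {p})"
    proof (intro ballI inj_onI)
      fix p x y assume p: "p \<in> H" and x: "x \<in> H - {p}" and y: "y \<in> H - {p}"
        and eq: "?d p x = ?d p y"
      let ?u = "?d p x"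
      have u: "?u \<in> S" using into x by blast
      have "p \<in> line q ?u (B ?u p)" "x \<in> line q ?u (B ?u p)" "y \<in> line q ?u (B ?u p)"
        using inter[OF p u] x y eq by auto
      with h line_in[OF u, of p] p x y show "x = y"
        unfolding hyperoval_def by blast
    qed
  next
    assume inj: "\<forall>p\<in>H. inj_on (?d p) (H - {p})"
    show "hyperoval q F H"
      unfolding hyperoval_def
    proof (intro conjI ballI impI notI)
      fix p x y assume p: "p \<in> H" and x: "x \<in> H" and y: "y \<in> H"
        and ne: "p \<noteq> x \<and> x \<noteq> y \<and> p \<noteq> y"
        and "\<exists>l\<in>ag_lines q F. p \<in> l \<and> x \<in> l \<and> y \<in> l"
      then obtain u c where u: "u \<in> S" and "B u p = c" "B u x = c" "B u y = c"
        by (auto simp: ag_lines_def mem_line)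
      then have "?d p x = u" "?d p y = u"
        using ne direction_eq_iff_line u by (auto simp: mem_line)
      with inj p x y ne show False unfolding inj_on_def by blast
    qed (use card in auto)
  qed
  show ?thesis
    unfolding hyp
  proof
    assume inj: "\<forall>p\<in>H. inj_on (?d p) (H - {p})"
    show "\<forall>u\<in>S. \<forall>c\<in>F. even (card (H \<inter> line q u c))"
    proof (intro ballI)
      fix u c assume u: "u \<in> S" and "c \<in> F"
      show "even (card (H \<inter> line q u c))"
      proof (cases "H \<inter> line q u c = {}")
        case False
        then obtain p where "p \<in> H" "p \<in> line q u c" by blast
        then have p: "p \<in> H" "B u p = c" by (simp_all add: mem_line)
        have inj': "inj_on (?d p) (H - {p})" using inj p by blast
        \<comment> \<open>An injection of q + 1 points into q + 1 directions is onto, so the line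
          has a second point of \<open>H\<close>.\<close>
        have "?d p ` (H - {p}) = S"
          by (rule card_subset_eq[OF finite into]) (simp only: card_image[OF inj'] card'[OF p(1)])
        with u have "u \<in> ?d p ` (H - {p})" by (simp only:)
        then obtain x where x: "x \<in> H - {p}" "?d p x = u" by (elim imageE) simp
        then have "{x \<in> H - {p}. ?d p x = u} = {x}" using inj' unfolding inj_on_def by blast
        then have "H \<inter> line q u c = {p, x}" using inter[OF p(1) u] p(2) by simp
        then show ?thesis using x by auto
      qed simp
    qed
  next
    assume even: "\<forall>u\<in>S. \<forall>c\<in>F. even (card (H \<inter> line q u c))"
    show "\<forall>p\<in>H. inj_on (?d p) (H - {p})"
    proof
      fix p assume p: "p \<in> H"
      have "u \<in> ?d p ` (H - {p})" if u: "u \<in> S" for u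
      proof (rule ccontr)
        assume "u \<notin> ?d p ` (H - {p})"
        then have "{x \<in> H - {p}. ?d p x = u} = {}" by auto
        then have "H \<inter> line q u (B u p) = {p}" by (simp only: inter[OF p u])
        moreover have "even (card (H \<inter> line q u (B u p)))"
          using even u bform_in_F by blast
        ultimately show False by simp
      qed
      then have "?d p ` (H - {p}) = S" by (intro subset_antisym into subsetI)
      then show "inj_on (?d p) (H - {p})"
        using card'[OF p] by (intro eq_card_imp_inj_on) simp_all
    qed
  qed
qed

section \<open>Parity of fibres and power sums\<close>

lemma sum_powers_indicator:
  assumes "t \<in> F"
  shows "(\<Sum>k=1..q-1. t ^ k) = of_bool (t = 1)"
proof (cases "t = 1")
  case True
  have "odd (q - 1)" using q q_ge2 by (cases m) auto
  then have "of_nat (q - 1) = (1::'a)" by (auto elim!: oddE simp: two_zero)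
  then show ?thesis using True by simp
next
  case False
  \<comment> \<open>The geometric sum telescopes to t - t^q, which vanishes on
    \<open>F\<close>.\<close>
  have "(1 - t) * (\<Sum>k=1..q-1. t ^ k) = t ^ 1 - t ^ Suc (q - 1)"
    using q_ge2 by (intro sum_gp_multiplied) simp
  also have "\<dots> = 0" using assms q_ge2 by (simp add: F_iff)
  finally show ?thesis using False by simp
qed

text \<open>Grouping a power sum by values weights \<open>c ^ k\<close> with a fibre size, which
  matters only modulo 2; the fibre over 0 drops out because \<open>k \<ge> 1\<close>. Conversely,
  the indicator of \<open>f x = c\<close> is a combination of powers of \<open>f x\<close>, so the
  fibre size modulo 2 is one of power sums.\<close>

lemma even_fibres_iff_power_sums:
  assumes "finite A" and f: "\<And>x. x \<in> A \<Longrightarrow> f x \<in> F"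
  shows "(\<forall>c\<in>F-{0}. even (card {x \<in> A. f x = c})) \<longleftrightarrow> (\<forall>k\<in>{1..q}. (\<Sum>x\<in>A. f x ^ k) = 0)"
proof
  assume even: "\<forall>c\<in>F-{0}. even (card {x \<in> A. f x = c})"
  show "\<forall>k\<in>{1..q}. (\<Sum>x\<in>A. f x ^ k) = 0"
  proof
    fix k assume k: "k \<in> {1..q}"
    have "(\<Sum>x\<in>A. f x ^ k) = (\<Sum>c\<in>F. \<Sum>x\<in>{x \<in> A. f x = c}. f x ^ k)"
      by (rule sum.group[symmetric]) (use assms in auto)
    also have "\<dots> = (\<Sum>c\<in>F. of_nat (card {x \<in> A. f x = c}) * c ^ k)"
      by simp
    also have "\<dots> = 0"
    proof (rule sum.neutral, rule ballI)
      fix c assume "c \<in> F"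
      then show "of_nat (card {x \<in> A. f x = c}) * c ^ k = 0"
        using even k by (cases "c = 0") (auto simp: of_nat_even)
    qed
    finally show "(\<Sum>x\<in>A. f x ^ k) = 0" .
  qed
next
  assume sums: "\<forall>k\<in>{1..q}. (\<Sum>x\<in>A. f x ^ k) = 0"
  show "\<forall>c\<in>F-{0}. even (card {x \<in> A. f x = c})"
  proof
    fix c assume c: "c \<in> F - {0}"
    have "of_nat (card {x \<in> A. f x = c}) = (\<Sum>x\<in>A. of_bool (f x / c = 1) :: 'a)"
      using c assms(1) by (simp add: Int_def)
    also have "\<dots> = (\<Sum>x\<in>A. \<Sum>k=1..q-1. (f x / c) ^ k)"
      using c f by (intro sum.cong sum_powers_indicator[symmetric] F_closed) auto
    also have "\<dots> = (\<Sum>k=1..q-1. (\<Sum>x\<in>A. f x ^ k) / c ^ k)"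
      by (subst sum.swap) (simp add: power_divide sum_divide_distrib)
    also have "\<dots> = 0" using sums by (intro sum.neutral) auto
    finally show "even (card {x \<in> A. f x = c})" by (simp add: of_nat_even)
  qed
qed

end

section \<open>The point set defined by \<open>g\<close>\<close>

locale plane_function = plane m q F for m q :: nat and F :: "'a::{field,finite} set" +
  fixes g :: "'a \<Rightarrow> 'a"
  assumes g: "\<And>u. u \<in> unit_circle q \<Longrightarrow> g u \<in> F"
           "\<And>u. u \<in> unit_circle q \<Longrightarrow> g u \<noteq> 0"
begin

abbreviation "pt u \<equiv> u / g u"
abbreviation "H \<equiv> pt ` S \<union> {0}"

lemma inj_on_pt: "inj_on pt S"
proof (rule inj_onI)
  fix u w assume uw: "u \<in> S" "w \<in> S" "pt u = pt w"
  then have "inverse (g u) * u = inverse (g w) * w" by (simp add: field_simps)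
  then show "u = w"
    using polar_unique(1)[of "inverse (g u)" "inverse (g w)" u w] uw g F_closed(5) by auto
qed

lemma zero_notin_pt: "0 \<notin> pt ` S"
  using S_nonzero g by auto

lemma card_H: "card H = q + 2"
  using zero_notin_pt by (simp add: card_image[OF inj_on_pt] card_unit_circle)

text \<open>Since \<open>B w (pt u) = B w u / g u\<close> vanishes only for \<open>u = w\<close>, a
  line through 0 contains just 0 and \<open>pt w\<close>.\<close>

lemma card_line_zero:
  assumes "w \<in> S"
  shows "card (H \<inter> line q w 0) = 2"
proof -
  have "H \<inter> line q w 0 = {pt w, 0}"
    using assms g bform_unit_eq_0[OF assms] by (auto simp: mem_line bform_0 bform_divide)
  then show ?thesis using assms S_nonzero g by simp
qed

lemma card_line_nonzero:
  assumes "c \<noteq> 0"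
  shows "card (H \<inter> line q w c) = card {u \<in> S. B w (pt u) = c}"
proof -
  have "H \<inter> line q w c = pt ` {u \<in> S. B w (pt u) = c}"
    using assms by (auto simp: mem_line bform_0)
  then show ?thesis
    using card_image[OF inj_on_subset[OF inj_on_pt]] by simp
qed

text \<open>Without signs, the equation reads \<open>g u = B w u / c\<close>; exchanging
  \<open>c\<close> and \<open>g u\<close> turns it into incidence of \<open>pt u\<close> with a line
  missing 0.\<close>

lemma solutions_polar:
  assumes "c \<in> F" "c \<noteq> 0"
  shows "{u \<in> S. g u + B u (inverse c * w) = 0} = {u \<in> S. B w (pt u) = c}"
proof (rule Collect_cong, rule conj_cong[OF refl])
  fix u assume "u \<in> S"
  then have gu: "g u \<in> F" "g u \<noteq> 0" using g by auto
  have e1: "B u (inverse c * w) = B w u / c"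
    using assms F_closed(5)[of c] by (simp add: bform_scale bform_commute[of w] divide_inverse)
  have e2: "B w (pt u) = B w u / g u"
    using gu bform_divide by blast
  show "g u + B u (inverse c * w) = 0 \<longleftrightarrow> B w (pt u) = c"
    unfolding add_eq_0 e1 e2 using assms gu by (auto simp: field_simps)
qed

lemma even_solutions_iff:
  "(\<forall>b. even (card {u \<in> S. g u + B u b = 0})) \<longleftrightarrow>
   (\<forall>w\<in>S. \<forall>c\<in>F-{0}. even (card {u \<in> S. B w (pt u) = c}))"
proof
  assume "\<forall>b. even (card {u \<in> S. g u + B u b = 0})"
  then show "\<forall>w\<in>S. \<forall>c\<in>F-{0}. even (card {u \<in> S. B w (pt u) = c})"
    by (auto simp flip: solutions_polar)
next
  assume even: "\<forall>w\<in>S. \<forall>c\<in>F-{0}. even (card {u \<in> S. B w (pt u) = c})"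
  show "\<forall>b. even (card {u \<in> S. g u + B u b = 0})"
  proof
    fix b
    show "even (card {u \<in> S. g u + B u b = 0})"
    proof (cases "b = 0")
      \<comment> \<open>No line corresponds to \<open>b = 0\<close>; there the count is zero because
        \<open>g\<close> has no zeros on \<open>S\<close>. Any other \<open>b\<close> is
        \<open>d * w\<close> and yields the line with \<open>c = inverse d\<close>.\<close>
      case True
      then have "{u \<in> S. g u + B u b = 0} = {}" using g by (auto simp: bform_0)
      then show ?thesis by (simp only: card.empty even_zero)
    next
      case False
      then obtain d w where dw: "d \<in> F" "d \<noteq> 0" "w \<in> S" "b = d * w" using polar by metis
      then show ?thesis
        using even solutions_polar[of "inverse d" w] F_closed(5)[of d] by simp
    qed
  qed
qed

lemma hyperoval_iff:
  "hyperoval q F H \<longleftrightarrow> (\<forall>w\<in>S. \<forall>c\<in>F-{0}. even (card {u \<in> S. B w (pt u) = c}))"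
  unfolding hyperoval_iff_even[OF card_H]
proof (rule ball_cong[OF refl])
  fix w assume w: "w \<in> S"
  have "even (card (H \<inter> line q w c)) \<longleftrightarrow> c = 0 \<or> even (card {u \<in> S. B w (pt u) = c})" for c
    using card_line_zero[OF w] card_line_nonzero[of c w] by (cases "c = 0") simp_all
  then show "(\<forall>c\<in>F. even (card (H \<inter> line q w c))) \<longleftrightarrow>
      (\<forall>c\<in>F-{0}. even (card {u \<in> S. B w (pt u) = c}))"
    by blast
qed

end

theorem theorem4p3:
  fixes m q :: nat and F :: "'a::{field,finite} set" and g :: "'a \<Rightarrow> 'a" and H :: "'a set"
  assumes q: "q = 2 ^ m"
    and K: "CARD('a) = q ^ 2"
    and F: "is_subfield F" "card F = q"
    and g: "\<And>u. u \<in> unit_circle q \<Longrightarrow> g u \<in> F"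
           "\<And>u. u \<in> unit_circle q \<Longrightarrow> g u \<noteq> 0"
    and H: "H = {u / g u | u. u \<in> unit_circle q} \<union> {0}"
  shows "(hyperoval q F H \<longleftrightarrow>
            (\<forall>b. even (card {u \<in> unit_circle q. g u + bform q u b = 0}))) \<and>
         ((\<forall>b. even (card {u \<in> unit_circle q. g u + bform q u b = 0})) \<longleftrightarrow>
            (\<forall>v\<in>unit_circle q. \<forall>k\<in>{1..q}.
               (\<Sum>u\<in>unit_circle q. (bform q v (u / g u)) ^ k) = 0))"
proof -
  interpret plane_function m q F g
    by unfold_locales (use q K F g in auto)
  have "H = (\<lambda>u. u / g u) ` unit_circle q \<union> {0}" using H by blast
  \<comment> \<open>For each fixed \<open>v\<close>, the power sum criterion is applied to the
    \<open>F\<close>-valued function sending \<open>u\<close> to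
    \<open>B v (u / g u)\<close>.\<close>
  moreover have "(\<forall>c\<in>F-{0}. even (card {u \<in> S. B v (u / g u) = c})) \<longleftrightarrow>
      (\<forall>k\<in>{1..q}. (\<Sum>u\<in>S. B v (u / g u) ^ k) = 0)" for v
    by (intro even_fibres_iff_power_sums finite bform_in_F)
  ultimately show ?thesis
    by (simp only: hyperoval_iff even_solutions_iff)
qed

end
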